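(* Let $x_1,x_2$ be arbitrary numbers, let $(a_n)$ and $(b_n)$ be arbitrary sequences of numbers, and let $x_n=a_nx_{n-1}+b_nx_{n-2}$ for $n\geqslant 3$. Then for every $n\geqslant 3$, $$ x_n=\sum_{\substack{2^{n-2}+1\leqslant j\leqslant 2^{n-1}\\ \vartheta(2^{n-1}-j+1)=1}}\bigl((x_2-x_1)[1,1]_j+x_1\bigr)\prod_{\substack{0\leqslant k\leqslant n-3\\ [3\cdot 2^k,\,2^k]_j=1}}a_{k+3}\ \prod_{\substack{0\leqslant k\leqslant n-3\\ [2^k,\,2^k]_j=0}}b_{k+3}, $$ where $\vartheta(m)=\prod_{k=0}^{\infty}\bigl(1-[3\cdot 2^k,2^k]_m\bigr)$ for positive integers $m$.
   Context: "Number" means complex number. For positive integers $l,m,j$, $[l,m]_j\in\{0,1\}$ denotes the $j$th element (indices starting at $1$) of the infinite periodic sequence of period $l+m$ whose period consists of $l$ zeros followed by $m$ ones; equivalently $[l,m]_j=\lceil (j+m)/(l+m)\rceil-\lceil j/(l+m)\rceil$. Empty products equal $1$. In the infinite product defining $\vartheta(m)$ all factors lie in $\{0,1\}$ and all but finitely many equal $1$. *)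

theory Defs
  imports "HOL-Analysis.Analysis"
begin

(* Positions j are counted from 1, so j occupies place (j - 1) mod (l + m) of the period.
   The value at j = 0 is junk. *)
definition zeros_ones :: "nat \<Rightarrow> nat \<Rightarrow> nat \<Rightarrow> int" where
  "zeros_ones l m j = (if (j - 1) mod (l + m) < l then 0 else 1)"

lemma zeros_ones_ceiling:
  assumes "l > 0" "m > 0" "j > 0"
  shows "zeros_ones l m j
           = \<lceil>real (j + m) / real (l + m)\<rceil> - \<lceil>real j / real (l + m)\<rceil>"
proof -
  define p where "p = l + m"
  define q r where "q = (j - 1) div p" and "r = (j - 1) mod p"
  have p: "p > 0" and r: "r < p"
    using assms by (auto simp: p_def r_def)
  have j: "j = q * p + r + 1"
    using assms by (simp add: q_def r_def)
  have c1: "\<lceil>real j / real p\<rceil> = int q + 1"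
    using p r by (intro ceiling_unique) (auto simp: j field_simps simp flip: of_nat_mult of_nat_add)
  show ?thesis
  proof (cases "r < l")
    case True
    have "\<lceil>real (j + m) / real p\<rceil> = int q + 1"
      using p True assms by (intro ceiling_unique) (auto simp: j p_def field_simps)
    with c1 True show ?thesis
      by (simp add: zeros_ones_def p_def r_def)
  next
    case False
    have "\<lceil>real (j + m) / real p\<rceil> = int q + 2"
      using p False r assms by (intro ceiling_unique) (auto simp: j p_def field_simps)
    with c1 False show ?thesis
      by (simp add: zeros_ones_def p_def r_def)
  qed
qed

definition theta :: "nat \<Rightarrow> int" where
  "theta m = (\<Prod>k. 1 - zeros_ones (3 * 2 ^ k) (2 ^ k) m)"

end

theory Submission
  imports Defs
begin

text \<open>
  Unrolling the recurrence from \<open>x n\<close> down to \<open>x 1\<close> or \<open>x 2\<close> gives one summand for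
  every descent of the index by steps of one (each contributing a factor \<open>a\<close>) and of two (each
  contributing a factor \<open>b\<close>). The formula is this sum over descents, with a descent recorded by
  the binary digits of \<open>i = j - 1\<close>: digit \<open>k\<close> is one iff the descent visits the index \<open>k + 2\<close>.
  As \<open>n\<close> is visited, the leading digit \<open>n - 2\<close> is one, which is the range of \<open>j\<close>. As no two
  consecutive indices are skipped, no two adjacent digits are zero. Digit 0 tells whether the descent
  ends at \<open>x 2\<close> or at \<open>x 1\<close>. A step of one from \<open>k + 3\<close> to \<open>k + 2\<close> shows as the digits \<open>k\<close>
  and \<open>k + 1\<close> both being one, and a step of two from \<open>k + 3\<close> to \<open>k + 1\<close> shows as digit \<open>k\<close>
  being zero.

  The periodic sequences read off exactly these digits: \<open>[2^k, 2^k]\<close> is digit \<open>k\<close> of \<open>i\<close>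
  (\<open>zeros_ones_bit\<close>) and \<open>[3 * 2^k, 2^k]\<close> is the conjunction of the digits \<open>k\<close> and \<open>k + 1\<close>
  (\<open>zeros_ones_adjacent_bits\<close>). Hence \<open>theta m = 1\<close> forbids adjacent ones in \<open>m - 1\<close>.
  For \<open>m = 2^(n-1) - j + 1\<close> the digits of \<open>m - 1\<close> below \<open>n - 1\<close> are those of \<open>i\<close>
  complemented, so adjacent zeros of \<open>i\<close> are forbidden
  (\<open>theta_complement_iff_admissible\<close>). The sum over descents satisfies the recurrence because
  the first step of a descent splits the digit strings into two classes
  (\<open>admissible_Suc_Suc\<close>), whose weights are those of shorter descents times \<open>a n\<close> or \<open>b n\<close>
  (\<open>recurrence_eq_sum_weight\<close>).
\<close>

section \<open>Binary digits of natural numbers\<close>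

lemma not_bit_above:
  fixes i :: nat
  assumes "i < 2 ^ K" "K \<le> k"
  shows "\<not> bit i k"
proof -
  have "i < 2 ^ k"
    using assms by (meson less_le_trans one_le_numeral power_increasing)
  then show ?thesis
    by (simp add: bit_iff_odd)
qed

lemma bit_top_iff:
  fixes i :: nat
  assumes "i < 2 ^ Suc K"
  shows "bit i K \<longleftrightarrow> 2 ^ K \<le> i"
proof (cases "2 ^ K \<le> i")
  case True
  then have "i div 2 ^ K = 1"
    using assms by (intro div_nat_eqI) auto
  with True show ?thesis
    by (simp add: bit_iff_odd)
next
  case False
  then show ?thesis
    using not_bit_above[of i K K] by simp
qed

text \<open>
  Subtraction from the all-ones number \<open>2 ^ K - 1\<close> never borrows, so it flips each of the lowest
  \<open>K\<close> digits.
\<close>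
lemma bit_complement_nat:
  includes bit_operations_syntax
  fixes i :: nat
  assumes "i < 2 ^ K"
  shows "bit (2 ^ K - Suc i) k \<longleftrightarrow> k < K \<and> \<not> bit i k"
proof -
  have "int (2 ^ K - Suc i) = mask K - take_bit K (int i)"
    using assms by (simp add: mask_eq_exp_minus_1 take_bit_int_eq_self of_nat_diff)
  also have "\<dots> = take_bit K (NOT (int i))"
    by (simp add: take_bit_not_eq_mask_diff)
  finally have "bit (int (2 ^ K - Suc i)) k \<longleftrightarrow> k < K \<and> \<not> bit (int i) k"
    by (simp add: bit_take_bit_iff bit_not_int_iff)
  then show ?thesis
    by (simp add: bit_of_nat_iff_bit)
qed

lemma bit_leading_one:
  includes bit_operations_syntax
  fixes i :: nat
  assumes "i < 2 ^ K"
  shows "bit (2 ^ K + i) k \<longleftrightarrow> k = K \<or> bit i k"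
proof -
  have "2 ^ K AND i = 0"
    using not_bit_above[OF assms] by (intro bit_eqI) (auto simp: bit_and_iff bit_exp_iff)
  then show ?thesis
    by (auto simp: disjunctive_add_eq_or bit_or_iff bit_exp_iff)
qed

section \<open>The periodic sequences as digit tests\<close>

text \<open>
  The remainder of \<open>i\<close> modulo \<open>2 ^ (k + 1)\<close> is at least \<open>2 ^ k\<close> exactly when its top digit,
  digit \<open>k\<close>, is one.
\<close>
lemma zeros_ones_bit:
  "zeros_ones (2 ^ k) (2 ^ k) (Suc i) = of_bool (bit i k)"
proof -
  have "i mod (2 ^ k + 2 ^ k) = 2 ^ k * ((i div 2 ^ k) mod 2) + i mod 2 ^ k"
    using mod_mult2_eq[of i "2 ^ k" 2] by (simp add: mult_2_right)
  then show ?thesis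
    by (cases "even (i div 2 ^ k)") (auto simp: zeros_ones_def bit_iff_odd odd_iff_mod_2_eq_one)
qed

text \<open>
  The period is \<open>2 ^ (k + 2)\<close>, so the two top digits of the remainder are the digits \<open>k + 1\<close> and
  \<open>k\<close> of \<open>i\<close>; the last quarter of the period is where both are one.
\<close>
lemma zeros_ones_adjacent_bits:
  "zeros_ones (3 * 2 ^ k) (2 ^ k) (Suc i) = of_bool (bit i k \<and> bit i (Suc k))"
proof -
  define q r where "q = i div 2 ^ k" and "r = i mod 2 ^ k"
  have "i mod (3 * 2 ^ k + 2 ^ k) = 2 ^ k * (q mod 4) + r"
    using mod_mult2_eq[of i "2 ^ k" 4] by (simp add: q_def r_def mult.commute)
  moreover have "r < 2 ^ k"
    by (simp add: r_def)
  moreover have "bit i k \<longleftrightarrow> odd q" "bit i (Suc k) \<longleftrightarrow> odd (q div 2)"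
    by (simp_all add: bit_iff_odd q_def div_mult2_eq power_Suc2 del: power_Suc)
  moreover have "q mod 4 = 0 \<or> q mod 4 = 1 \<or> q mod 4 = 2 \<or> q mod 4 = 3"
    by linarith
  moreover have "odd q \<and> odd (q div 2) \<longleftrightarrow> q mod 4 = 3"
    by presburger
  ultimately show ?thesis
    by (auto simp: zeros_ones_def)
qed

text \<open>
  All factors are 0 or 1, and those with \<open>k \<ge> i\<close> are 1 because digit \<open>k\<close> of \<open>i\<close> vanishes; so the
  infinite product is a finite one, equal to 1 iff every factor is.
\<close>
lemma theta_eq_1_iff:
  "theta (Suc i) = 1 \<longleftrightarrow> (\<forall>k. \<not> (bit i k \<and> bit i (Suc k)))"
proof -
  define f :: "nat \<Rightarrow> int" where "f k = 1 - of_bool (bit i k \<and> bit i (Suc k))" for k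
  have small: "\<not> bit i k" if "k \<ge> i" for k
    using not_bit_above[of i i k] less_exp[of i] that by simp
  have "theta (Suc i) = (\<Prod>k. f k)"
    by (simp add: theta_def f_def zeros_ones_adjacent_bits)
  also have "\<dots> = (\<Prod>k<i. f k)"
    by (rule has_prod_unique[symmetric], rule has_prod_finite) (auto simp: f_def small)
  also have "\<dots> = 1 \<longleftrightarrow> (\<forall>k<i. f k = 1)"
  proof
    assume one: "(\<Prod>k<i. f k) = 1"
    show "\<forall>k<i. f k = 1"
    proof (rule ccontr)
      assume "\<not> (\<forall>k<i. f k = 1)"
      then have "\<exists>k<i. f k = 0"
        by (auto simp: f_def)
      then have "(\<Prod>k<i. f k) = 0"
        by (auto intro: prod_zero)
      with one show False
        by simp
    qed
  qed auto
  also have "\<dots> \<longleftrightarrow> (\<forall>k. \<not> (bit i k \<and> bit i (Suc k)))"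
    using small by (auto simp: f_def not_le) (meson not_le)
  finally show ?thesis .
qed

section \<open>Descents and their weights\<close>

text \<open>
  The digit strings of the descents that start at the index \<open>N\<close>, when the initial values of the
  sequence sit at the indices -1 and 0. Digit \<open>k\<close> records a visit to the index \<open>k\<close>; the value at
  the index -1 is reached precisely when digit 0 is zero.
\<close>
definition admissible :: "nat \<Rightarrow> nat set" where
  "admissible N =
     {i. 2 ^ N \<le> i \<and> i < 2 ^ Suc N \<and> (\<forall>k<N. bit i k \<or> bit i (Suc k))}"

text \<open>
  The summand of one descent: \<open>u\<close> and \<open>v\<close> are the values at the indices -1 and 0, and the
  coefficients \<open>a k\<close> and \<open>b k\<close> are those of the step that leaves the index \<open>k + 1\<close>.
\<close>
definition weight :: "'a \<Rightarrow> 'a \<Rightarrow> (nat \<Rightarrow> 'a) \<Rightarrow> (nat \<Rightarrow> 'a) \<Rightarrow> nat \<Rightarrow> nat \<Rightarrow> 'a::comm_ring_1" where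
  "weight u v a b N i =
     (if bit i 0 then v else u)
     * (\<Prod>k \<in> {k. k < N \<and> bit i k \<and> bit i (Suc k)}. a k)
     * (\<Prod>k \<in> {k. k < N \<and> \<not> bit i k}. b k)"

lemma finite_admissible [simp]: "finite (admissible N)"
  by (rule finite_subset[of _ "{..<2 ^ Suc N}"]) (auto simp: admissible_def)

lemma admissibleD:
  assumes "i \<in> admissible N"
  shows "i < 2 ^ Suc N" "bit i N"
  using assms bit_top_iff[of i N] by (auto simp: admissible_def)

text \<open>
  Below the leading one, either the next digit is one and leads a shorter admissible string, or it
  is zero and forces the digit after it to be one, which then leads such a string.
  Conversely, prepending a one, or a one and a zero, to an admissible string creates no adjacent
  zeros, as the string starts with a one.
\<close>
lemma admissible_Suc_Suc:
  "admissible (Suc (Suc M)) =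
     (+) (2 ^ Suc (Suc M)) ` (admissible (Suc M) \<union> admissible M)"
proof (intro equalityI subsetI)
  fix i assume i: "i \<in> admissible (Suc (Suc M))"
  define i' where "i' = i - 2 ^ Suc (Suc M)"
  have eq: "i = 2 ^ Suc (Suc M) + i'" and lt: "i' < 2 ^ Suc (Suc M)"
    using i by (auto simp: admissible_def i'_def)
  note bits = bit_leading_one[OF lt]
  have adj: "bit i' k \<or> bit i' (Suc k)" if "k < Suc M" for k
  proof -
    have "bit i k \<or> bit i (Suc k)"
      using i that by (simp add: admissible_def)
    then show ?thesis
      using that unfolding eq bits by auto
  qed
  have "i' \<in> admissible (Suc M) \<union> admissible M"
  proof (cases "2 ^ Suc M \<le> i'")
    case True
    then show ?thesis
      using lt adj by (auto simp: admissible_def)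
  next
    case False
    then have lt': "i' < 2 ^ Suc M"
      by simp
    then have "bit i' M"
      using adj[of M] not_bit_above[OF lt', of "Suc M"] by simp
    then show ?thesis
      using lt' adj bit_top_iff[OF lt'] by (auto simp: admissible_def)
  qed
  then show "i \<in> (+) (2 ^ Suc (Suc M)) ` (admissible (Suc M) \<union> admissible M)"
    using eq by blast
next
  fix i assume "i \<in> (+) (2 ^ Suc (Suc M)) ` (admissible (Suc M) \<union> admissible M)"
  then obtain i' where eq: "i = 2 ^ Suc (Suc M) + i'"
    and i': "i' \<in> admissible (Suc M) \<or> i' \<in> admissible M"
    by auto
  have lt: "i' < 2 ^ Suc (Suc M)"
    using i' by (auto simp: admissible_def)
  have bits: "bit i k \<longleftrightarrow> k = Suc (Suc M) \<or> bit i' k" for k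
    unfolding eq by (rule bit_leading_one[OF lt])
  have "bit i' k \<or> bit i' (Suc k) \<or> k = Suc M" if "k < Suc (Suc M)" for k
    using i'
  proof
    assume "i' \<in> admissible (Suc M)"
    then show ?thesis
      using that by (auto simp: admissible_def less_Suc_eq)
  next
    assume *: "i' \<in> admissible M"
    then show ?thesis
      using that admissibleD(2)[OF *] by (auto simp: admissible_def less_Suc_eq)
  qed
  then show "i \<in> admissible (Suc (Suc M))"
    using lt bits eq unfolding admissible_def by auto
qed

text \<open>
  Prepending a one makes the digits \<open>N\<close> and \<open>N + 1\<close> both one, which adds the factor \<open>a N\<close>; it
  adds no zero digit below the new leading one.
\<close>
lemma weight_step_one:
  assumes "i \<in> admissible N"
  shows "weight u v a b (Suc N) (2 ^ Suc N + i) = a N * weight u v a b N i"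
proof -
  note lt = admissibleD(1)[OF assms] and top = admissibleD(2)[OF assms]
  note bits = bit_leading_one[OF lt]
  have "{k. k < Suc N \<and> bit (2 ^ Suc N + i) k \<and> bit (2 ^ Suc N + i) (Suc k)}
      = insert N {k. k < N \<and> bit i k \<and> bit i (Suc k)}"
    unfolding bits using top by auto
  moreover have "{k. k < Suc N \<and> \<not> bit (2 ^ Suc N + i) k} = {k. k < N \<and> \<not> bit i k}"
    unfolding bits using top by (auto simp: less_Suc_eq)
  moreover have "bit (2 ^ Suc N + i) 0 \<longleftrightarrow> bit i 0"
    unfolding bits by simp
  ultimately show ?thesis
    unfolding weight_def by simp
qed

text \<open>
  Prepending a one and a zero adds the zero digit \<open>N + 1\<close>, hence the factor \<open>b (N + 1)\<close>; this
  zero separates the ones at \<open>N\<close> and \<open>N + 2\<close>, so no adjacent ones arise.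
\<close>
lemma weight_step_two:
  assumes "i \<in> admissible N"
  shows "weight u v a b (Suc (Suc N)) (2 ^ Suc (Suc N) + i) = b (Suc N) * weight u v a b N i"
proof -
  note top = admissibleD(2)[OF assms] and above = not_bit_above[OF admissibleD(1)[OF assms]]
  have lt: "i < 2 ^ Suc (Suc N)"
    using admissibleD(1)[OF assms] by simp
  note bits = bit_leading_one[OF lt]
  have "{k. k < Suc (Suc N) \<and> bit (2 ^ Suc (Suc N) + i) k \<and> bit (2 ^ Suc (Suc N) + i) (Suc k)}
      = {k. k < N \<and> bit i k \<and> bit i (Suc k)}"
    unfolding bits using above by (auto simp: less_Suc_eq)
  moreover have "{k. k < Suc (Suc N) \<and> \<not> bit (2 ^ Suc (Suc N) + i) k}
      = insert (Suc N) {k. k < N \<and> \<not> bit i k}"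
    unfolding bits using top above by (auto simp: less_Suc_eq)
  moreover have "bit (2 ^ Suc (Suc N) + i) 0 \<longleftrightarrow> bit i 0"
    unfolding bits by simp
  ultimately show ?thesis
    unfolding weight_def by simp
qed

text \<open>
  The value \<open>y (N + 1)\<close> sits at the index \<open>N\<close>, so that digit \<open>k\<close> stands for \<open>y (k + 1)\<close>.
  The partition \<open>admissible_Suc_Suc\<close> turns the sum into one that obeys the recurrence, so two-step
  induction applies. The case \<open>N = 1\<close> is a separate base case, since a step of two from
  there leaves the range of the digits.
\<close>
lemma recurrence_eq_sum_weight:
  fixes y a b :: "nat \<Rightarrow> 'a::comm_ring_1"
  assumes rec: "\<And>k. y (Suc (Suc k)) = a k * y (Suc k) + b k * y k"
  shows "y (Suc N) = (\<Sum>i \<in> admissible N. weight (y 0) (y 1) a b N i)"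
proof (induction N rule: induct_nat_012)
  case 0
  have "admissible 0 = {1}"
    by (auto simp: admissible_def)
  then show ?case
    by (simp add: weight_def bit_0)
next
  case 1
  have "admissible 1 = {2, 3}"
    by (auto simp: admissible_def bit_0 bit_Suc)
  moreover have "weight (y 0) (y 1) a b 1 2 = b 0 * y 0"
  proof -
    have sets: "{k::nat. k < 1 \<and> bit (2::nat) k \<and> bit (2::nat) (Suc k)} = {}"
      "{k::nat. k < 1 \<and> \<not> bit (2::nat) k} = {0}"
      by (auto simp: bit_0 bit_Suc)
    show ?thesis
      unfolding weight_def sets by (simp add: bit_0)
  qed
  moreover have "weight (y 0) (y 1) a b 1 3 = a 0 * y 1"
  proof -
    have sets: "{k::nat. k < 1 \<and> bit (3::nat) k \<and> bit (3::nat) (Suc k)} = {0}"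
      "{k::nat. k < 1 \<and> \<not> bit (3::nat) k} = {}"
      by (auto simp: bit_0 bit_Suc intro!: gr0I)
    show ?thesis
      unfolding weight_def sets by (simp add: bit_0)
  qed
  ultimately show ?case
    using rec[of 0] by simp
next
  case (ge2 N)
  let ?w = "weight (y 0) (y 1) a b"
  have disj: "admissible (Suc N) \<inter> admissible N = {}"
    by (auto simp: admissible_def)
  have "(\<Sum>i \<in> admissible (Suc (Suc N)). ?w (Suc (Suc N)) i)
      = (\<Sum>i \<in> admissible (Suc N) \<union> admissible N. ?w (Suc (Suc N)) (2 ^ Suc (Suc N) + i))"
    unfolding admissible_Suc_Suc by (subst sum.reindex) (simp_all add: o_def)
  also have "\<dots> = (\<Sum>i \<in> admissible (Suc N). ?w (Suc (Suc N)) (2 ^ Suc (Suc N) + i))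
      + (\<Sum>i \<in> admissible N. ?w (Suc (Suc N)) (2 ^ Suc (Suc N) + i))"
    using disj by (intro sum.union_disjoint) simp_all
  also have "\<dots> = a (Suc N) * (\<Sum>i \<in> admissible (Suc N). ?w (Suc N) i)
      + b (Suc N) * (\<Sum>i \<in> admissible N. ?w N i)"
    unfolding sum_distrib_left
    by (intro arg_cong2[of _ _ _ _ "(+)"] sum.cong weight_step_one weight_step_two refl)
  also have "\<dots> = y (Suc (Suc (Suc N)))"
    using ge2 rec[of "Suc N"] by simp
  finally show ?case ..
qed

section \<open>The explicit formula\<close>

text \<open>
  Here \<open>i = j - 1\<close> and \<open>N = n - 2\<close>. The argument of \<open>theta\<close> is one more than the digitwise
  complement of \<open>i\<close>. The complement has no ones beyond position \<open>N\<close>, so its adjacent ones are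
  exactly the adjacent zeros of \<open>i\<close> at positions up to \<open>N\<close>.
\<close>
lemma theta_complement_iff_admissible:
  assumes "2 ^ N \<le> i" "i < 2 ^ Suc N"
  shows "theta (2 ^ Suc N - i) = 1 \<longleftrightarrow> i \<in> admissible N"
proof -
  have "2 ^ Suc N - i = Suc (2 ^ Suc N - Suc i)"
    using assms(2) by simp
  then have "theta (2 ^ Suc N - i) = 1 \<longleftrightarrow>
      (\<forall>k. \<not> (bit (2 ^ Suc N - Suc i) k \<and> bit (2 ^ Suc N - Suc i) (Suc k)))"
    by (simp only: theta_eq_1_iff)
  also have "\<dots> \<longleftrightarrow> (\<forall>k<N. bit i k \<or> bit i (Suc k))"
    unfolding bit_complement_nat[OF assms(2)] by auto
  finally show ?thesis
    using assms by (simp add: admissible_def)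
qed

theorem theorem2p2:
  fixes x a b :: "nat \<Rightarrow> complex" and n :: nat
  assumes "\<And>i. i \<ge> 3 \<Longrightarrow> x i = a i * x (i - 1) + b i * x (i - 2)"
    and "n \<ge> 3"
  shows "x n =
    (\<Sum>j \<in> {j. 2 ^ (n - 2) + 1 \<le> j \<and> j \<le> 2 ^ (n - 1) \<and> theta (2 ^ (n - 1) - j + 1) = 1}.
       ((x 2 - x 1) * of_int (zeros_ones 1 1 j) + x 1)
       * (\<Prod>k \<in> {k. k \<le> n - 3 \<and> zeros_ones (3 * 2 ^ k) (2 ^ k) j = 1}. a (k + 3))
       * (\<Prod>k \<in> {k. k \<le> n - 3 \<and> zeros_ones (2 ^ k) (2 ^ k) j = 0}. b (k + 3)))"
    (is "_ = (\<Sum>j \<in> ?J. ?t j)")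
proof -
  define N where "N = n - 2"
  have n: "n = N + 2" and le_iff: "k \<le> n - 3 \<longleftrightarrow> k < N" for k
    using assms(2) by (auto simp: N_def)
  have J: "?J = Suc ` admissible N"
  proof (intro equalityI subsetI)
    fix j assume j: "j \<in> ?J"
    then obtain i where i: "j = Suc i"
      by (cases j) auto
    with j have bounds: "2 ^ N \<le> i" "i < 2 ^ Suc N"
      by (simp_all add: n)
    have "2 ^ Suc N - j + 1 = 2 ^ Suc N - i"
      using bounds i by simp
    with j have "theta (2 ^ Suc N - i) = 1"
      by (simp add: n)
    then show "j \<in> Suc ` admissible N"
      using theta_complement_iff_admissible[OF bounds] i by simp
  next
    fix j assume "j \<in> Suc ` admissible N"
    then obtain i where i: "j = Suc i" and adm: "i \<in> admissible N"
      by auto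
    then have bounds: "2 ^ N \<le> i" "i < 2 ^ Suc N"
      by (auto simp: admissible_def)
    have "2 ^ Suc N - j + 1 = 2 ^ Suc N - i"
      using bounds i by simp
    then show "j \<in> ?J"
      using theta_complement_iff_admissible[OF bounds] adm bounds i by (simp add: n)
  qed
  have t: "?t (Suc i) = weight (x 1) (x 2) (\<lambda>k. a (k + 3)) (\<lambda>k. b (k + 3)) N i" for i
  proof -
    have "zeros_ones 1 1 (Suc i) = of_bool (bit i 0)"
      using zeros_ones_bit[of 0 i] by simp
    then show ?thesis
      unfolding weight_def le_iff by (simp add: zeros_ones_bit zeros_ones_adjacent_bits)
  qed
  have "x (Suc (Suc (Suc k))) = a (k + 3) * x (Suc (Suc k)) + b (k + 3) * x (Suc k)" for k
    using assms(1)[of "k + 3"] by (simp add: eval_nat_numeral)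
  from recurrence_eq_sum_weight[of "\<lambda>k. x (Suc k)" "\<lambda>k. a (k + 3)" "\<lambda>k. b (k + 3)" N, OF this]
  have "x n = (\<Sum>i \<in> admissible N.
      weight (x 1) (x 2) (\<lambda>k. a (k + 3)) (\<lambda>k. b (k + 3)) N i)"
    by (simp add: n numeral_2_eq_2)
  also have "\<dots> = (\<Sum>j \<in> Suc ` admissible N. ?t j)"
    unfolding t[symmetric] by (subst sum.reindex) (simp_all add: o_def)
  finally show ?thesis
    unfolding J .
qed

end
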